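(* Let $U\in\mathbb V^{n-1}$ and let $K^+,K^-\in\mathcal T^{n-1}$ be two sibling simplexes which are coarsened into their parent $K\in\mathcal T_0^n$. Define $\boldsymbol y=(y_0,\dots,y_L)$ by $$y_i:=\begin{cases}y^+_{d^+(i)}&\text{if }i\in C^+,\\ y^-_{d^-(i)}&\text{otherwise.}\end{cases}$$ Then the coarsening error resulting from coarsening $K^+,K^-$ into $K$ is given by $$\bigl[U-\Lambda_0^nU\bigr]\big|_{K^+}=\sum_{j\in\{0,\dots,L\}\setminus D^+}\Bigl(y^+_j-\sum_{i=0}^Ly_i[A^+]^i_j\Bigr)\pi^j_+,$$ $$\bigl[U-\Lambda_0^nU\bigr]\big|_{K^-}=\sum_{j\in\{0,\dots,L\}\setminus D^-}\Bigl(y^-_j-\sum_{i=0}^Ly_i[A^-]^i_j\Bigr)\pi^j_-.$$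
   Context: **Meshes and spaces.** $\mathcal T^{n-1}$ is a conforming simplicial triangulation of a bounded polyhedral domain $\Omega\subset\mathbb R^d$ and $\mathcal T_0^n$ is a conforming triangulation obtained from it by coarsening, i.e. by replacing certain pairs of sibling simplexes $K^+,K^-$ (the two children produced by bisecting a simplex $K$ through the midpoint of one of its edges) by their parent $K$. Let $p\ge1$ be fixed, $\mathbb P^p$ the polynomials of degree at most $p$; $\mathbb V^{n-1}$ and $\mathbb V^n_0$ are the spaces of functions in $H^1_0(\Omega)$ that are continuous piecewise $\mathbb P^p$ over $\mathcal T^{n-1}$ and $\mathcal T_0^n$ respectively. $\Lambda_0^n$ is the Lagrange interpolator onto $\mathbb V_0^n$. **Local notation.** Let $\{x_0,\dots,x_L\}$ and $\{x_0^\pm,\dots,x_L^\pm\}$ be the (standard equispaced degree-$p$) Lagrange nodes, in a fixed local ordering, on $K$ and $K^\pm$ respectively, and let $\{\pi^0,\dots,\pi^L\}$ and $\{\pi^0_\pm,\dots,\pi^L_\pm\}$ be the corresponding Lagrange bases of $\mathbb P^p$ on $K$ and on $K^\pm$: $\pi^i(x_j)=\pi^i_\pm(x^\pm_j)=\delta^i_j$. The coarse-on-fine matrices are $A^\pm=\bigl(\pi^i(x_j^\pm)\bigr)_{i,j=0,\dots,L}$, with entries $[A^\pm]^i_j=\pi^i(x^\pm_j)$ (row $i$, column $j$). The local coefficients of $U$ are $y^\pm_j$, defined by $U|_{K^\pm}=\sum_{j=0}^Ly^\pm_j\pi^j_\pm$. **Index maps.** $D^\pm:=\{j\in\{0,\dots,L\}:x_j^\pm\in\{x_0,\dots,x_L\}\}$.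 The fine-to-coarse map $c^\pm:D^\pm\to C^\pm$ is defined by $x_j^\pm=x_{c^\pm(j)}$, with image $C^\pm:=c^\pm(D^\pm)\subseteq\{0,\dots,L\}$; it is injective, and the coarse-to-fine map $d^\pm:C^\pm\to D^\pm$ is its inverse. One has $C^+\cup C^-=\{0,\dots,L\}$. *)

theory Defs
  imports "HOL-Analysis.Analysis"
begin

section \<open>The Sobolev space $H^1_0$\<close>

primrec Ck :: "nat \<Rightarrow> ('a::euclidean_space \<Rightarrow> real) \<Rightarrow> bool" where
  "Ck 0 f \<longleftrightarrow> continuous_on UNIV f"
| "Ck (Suc k) f \<longleftrightarrow>
     (\<forall>x. f differentiable (at x)) \<and> (\<forall>h. Ck k (\<lambda>x. frechet_derivative f (at x) h))"

definition test_functions :: "'a::euclidean_space set \<Rightarrow> ('a \<Rightarrow> real) set" where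
  "test_functions \<Omega> =
     {\<phi>. (\<forall>k. Ck k \<phi>) \<and> (\<exists>C. compact C \<and> C \<subseteq> \<Omega> \<and> (\<forall>x. x \<notin> C \<longrightarrow> \<phi> x = 0))}"

definition pderivative :: "'a::euclidean_space \<Rightarrow> ('a \<Rightarrow> real) \<Rightarrow> 'a \<Rightarrow> real" where
  "pderivative b \<phi> x = frechet_derivative \<phi> (at x) b"

definition L2 :: "'a::euclidean_space set \<Rightarrow> ('a \<Rightarrow> real) set" where
  "L2 \<Omega> = {f. f \<in> borel_measurable (lebesgue_on \<Omega>) \<and>
               integrable (lebesgue_on \<Omega>) (\<lambda>x. (f x)\<^sup>2)}"

definition weak_pderivative ::
    "'a::euclidean_space set \<Rightarrow> 'a \<Rightarrow> ('a \<Rightarrow> real) \<Rightarrow> ('a \<Rightarrow> real) \<Rightarrow> bool" where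
  "weak_pderivative \<Omega> b u g \<longleftrightarrow>
     (\<forall>\<phi>\<in>test_functions \<Omega>.
        integral\<^sup>L (lebesgue_on \<Omega>) (\<lambda>x. u x * pderivative b \<phi> x)
          = - integral\<^sup>L (lebesgue_on \<Omega>) (\<lambda>x. g x * \<phi> x))"

text \<open>
  The closure of the test functions in $H^1(\Omega)$, as a set of functions rather than of
  classes modulo null sets: \<open>G b\<close> is the weak derivative of \<open>u\<close> in direction \<open>b\<close>, and the limits
  say that \<open>\<phi> n\<close> converges to \<open>u\<close> in the $H^1$ norm. Values outside \<open>\<Omega>\<close> are irrelevant.
\<close>

definition H10 :: "'a::euclidean_space set \<Rightarrow> ('a \<Rightarrow> real) set" where
  "H10 \<Omega> = {u. u \<in> L2 \<Omega> \<and>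
     (\<exists>G. (\<forall>b\<in>Basis. G b \<in> L2 \<Omega> \<and> weak_pderivative \<Omega> b u (G b)) \<and>
       (\<exists>\<phi>::nat \<Rightarrow> 'a \<Rightarrow> real. (\<forall>n. \<phi> n \<in> test_functions \<Omega>) \<and>
         (\<lambda>n. integral\<^sup>L (lebesgue_on \<Omega>) (\<lambda>x. (\<phi> n x - u x)\<^sup>2)) \<longlonglongrightarrow> 0 \<and>
         (\<forall>b\<in>Basis.
           (\<lambda>n. integral\<^sup>L (lebesgue_on \<Omega>) (\<lambda>x. (pderivative b (\<phi> n) x - G b x)\<^sup>2))
             \<longlonglongrightarrow> 0)))}"


section \<open>Meshes and coarsening\<close>

definition polyhedral_domain :: "'a::euclidean_space set \<Rightarrow> bool" where
  "polyhedral_domain \<Omega> \<longleftrightarrow> open \<Omega> \<and> connected \<Omega> \<and> \<Omega> \<noteq> {} \<and>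
     (\<exists>P. finite P \<and> (\<forall>S\<in>P. polytope S) \<and> frontier \<Omega> = \<Union>P)"

text \<open>
  Conformity (any two elements meet in a common, possibly empty, face) is part of the library's
  \<^const>\<open>triangulation\<close>, which however lists simplexes of arbitrary dimension.
\<close>

definition mesh :: "'a::euclidean_space set \<Rightarrow> 'a set set \<Rightarrow> bool" where
  "mesh \<Omega> \<T> \<longleftrightarrow> triangulation \<T> \<and> (\<forall>K\<in>\<T>. int DIM('a) simplex K) \<and> \<Union>\<T> = closure \<Omega>"

definition bisected :: "'a::euclidean_space set \<Rightarrow> 'a set \<Rightarrow> 'a set \<Rightarrow> bool" where
  "bisected K K1 K2 \<longleftrightarrow>
     (\<exists>V a b. \<not> affine_dependent V \<and> card V = DIM('a) + 1 \<and> a \<in> V \<and> b \<in> V \<and> a \<noteq> b \<and>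
        K = convex hull V \<and>
        K1 = convex hull (insert (midpoint a b) (V - {b})) \<and>
        K2 = convex hull (insert (midpoint a b) (V - {a})))"

text \<open>
  \<open>S\<close> lists the triples (parent, child, child) for which the two children are replaced.
\<close>

definition coarsening :: "'a::euclidean_space set set \<Rightarrow> 'a set set \<Rightarrow> bool" where
  "coarsening \<T> \<T>\<^sub>0 \<longleftrightarrow>
     (\<exists>S. (\<forall>(K, K1, K2)\<in>S. bisected K K1 K2 \<and> K1 \<in> \<T> \<and> K2 \<in> \<T>) \<and>
          \<T>\<^sub>0 = (\<T> - (\<Union>(K, K1, K2)\<in>S. {K1, K2})) \<union> fst ` S)"


section \<open>Lagrange finite elements\<close>

definition multi_indices :: "nat \<Rightarrow> ('a::euclidean_space \<Rightarrow> nat) set" where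
  "multi_indices p = {\<alpha>. (\<forall>b. b \<notin> Basis \<longrightarrow> \<alpha> b = 0) \<and> (\<Sum>b\<in>Basis. \<alpha> b) \<le> p}"

definition polys :: "nat \<Rightarrow> ('a::euclidean_space \<Rightarrow> real) set" where
  "polys p = {q. \<exists>c. \<forall>x. q x = (\<Sum>\<alpha>\<in>multi_indices p. c \<alpha> * (\<Prod>b\<in>Basis. (x \<bullet> b) ^ \<alpha> b))}"

text \<open>
  The points of \<open>K\<close> whose barycentric coordinates are integer multiples of \<open>1/p\<close>; the vertices of a
  simplex are its extreme points.
\<close>

definition lagrange_nodes :: "nat \<Rightarrow> 'a::euclidean_space set \<Rightarrow> 'a set" where
  "lagrange_nodes p K =
     {(\<Sum>v\<in>{v. v extreme_point_of K}. (real (\<alpha> v) / real p) *\<^sub>R v) | \<alpha> :: 'a \<Rightarrow> nat.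
        (\<Sum>v\<in>{v. v extreme_point_of K}. \<alpha> v) = p}"

definition node_ordering :: "nat \<Rightarrow> 'a::euclidean_space set \<Rightarrow> nat \<Rightarrow> (nat \<Rightarrow> 'a) \<Rightarrow> bool" where
  "node_ordering p K L x \<longleftrightarrow> bij_betw x {0..L} (lagrange_nodes p K)"

definition lagrange_basis ::
    "nat \<Rightarrow> nat \<Rightarrow> (nat \<Rightarrow> 'a::euclidean_space) \<Rightarrow> (nat \<Rightarrow> 'a \<Rightarrow> real) \<Rightarrow> bool" where
  "lagrange_basis p L x \<pi> \<longleftrightarrow>
     (\<forall>i\<in>{0..L}. \<pi> i \<in> polys p) \<and>
     (\<forall>i\<in>{0..L}. \<forall>j\<in>{0..L}. \<pi> i (x j) = (if i = j then 1 else 0))"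

definition fe_space ::
    "'a::euclidean_space set \<Rightarrow> 'a set set \<Rightarrow> nat \<Rightarrow> ('a \<Rightarrow> real) set" where
  "fe_space \<Omega> \<T> p = {u. u \<in> H10 \<Omega> \<and> continuous_on (closure \<Omega>) u \<and>
     (\<forall>K\<in>\<T>. \<exists>q\<in>polys p. \<forall>\<xi>\<in>K. u \<xi> = q \<xi>)}"

text \<open>
  Nodal values determine an element of the finite element space on \<open>closure \<Omega>\<close>, so the condition
  fixes \<open>\<Lambda> v\<close> there. The nodes on the boundary may be included, because the domain of the
  operator consists of functions in $H^1_0(\Omega)$.
\<close>

definition lagrange_interpolator ::
    "'a::euclidean_space set \<Rightarrow> 'a set set \<Rightarrow> nat \<Rightarrow> (('a \<Rightarrow> real) \<Rightarrow> 'a \<Rightarrow> real) \<Rightarrow> bool" where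
  "lagrange_interpolator \<Omega> \<T> p \<Lambda> \<longleftrightarrow>
     (\<forall>v. v \<in> H10 \<Omega> \<and> continuous_on (closure \<Omega>) v \<longrightarrow>
        \<Lambda> v \<in> fe_space \<Omega> \<T> p \<and> (\<forall>K\<in>\<T>. \<forall>z\<in>lagrange_nodes p K. \<Lambda> v z = v z))"


section \<open>Coarse-on-fine matrices and index maps\<close>

text \<open>
  In the following \<open>x\<close> lists the nodes of the parent and \<open>x'\<close> those of one child, both indexed
  by \<open>{0..L}\<close>.
\<close>

definition coarse_on_fine :: "(nat \<Rightarrow> 'a \<Rightarrow> real) \<Rightarrow> (nat \<Rightarrow> 'a) \<Rightarrow> nat \<Rightarrow> nat \<Rightarrow> real" where
  "coarse_on_fine \<pi> x' i j = \<pi> i (x' j)"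

definition D_set :: "nat \<Rightarrow> (nat \<Rightarrow> 'a) \<Rightarrow> (nat \<Rightarrow> 'a) \<Rightarrow> nat set" where
  "D_set L x x' = {j\<in>{0..L}. x' j \<in> x ` {0..L}}"

definition c_map :: "nat \<Rightarrow> (nat \<Rightarrow> 'a) \<Rightarrow> (nat \<Rightarrow> 'a) \<Rightarrow> nat \<Rightarrow> nat" where
  "c_map L x x' j = (THE i. i \<in> {0..L} \<and> x' j = x i)"

definition C_set :: "nat \<Rightarrow> (nat \<Rightarrow> 'a) \<Rightarrow> (nat \<Rightarrow> 'a) \<Rightarrow> nat set" where
  "C_set L x x' = c_map L x x' ` D_set L x x'"

definition d_map :: "nat \<Rightarrow> (nat \<Rightarrow> 'a) \<Rightarrow> (nat \<Rightarrow> 'a) \<Rightarrow> nat \<Rightarrow> nat" where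
  "d_map L x x' = the_inv_into (D_set L x x') (c_map L x x')"

end

theory Submission
  imports Defs "HOL-Library.Function_Algebras"
begin

text \<open>
  A nodal basis of \<open>polys p\<close> exists by hypothesis, so unisolvence on a simplex needs only a
  dimension count: there are at least as many Lagrange nodes as monomials of degree at most \<open>p\<close>.
  Hence every polynomial is expanded by its nodal values. Every node of the parent is a node of one
  of the children, which identifies the \<open>y i\<close> as the nodal values of \<open>U\<close> on the parent. Expanding
  the interpolant in the nodal basis of a child gives its coefficients, and on the nodes in \<open>D\<close>
  these agree with those of \<open>U\<close>.
\<close>

section \<open>Expansion with respect to a dual system of points\<close>

lemma sum_fun_apply: "(\<Sum>i\<in>I. f i) x = (\<Sum>i\<in>I. f i x)" for f :: "'i \<Rightarrow> 'b \<Rightarrow> real"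
  by (induction I rule: infinite_finite_induct) auto

text \<open>Evaluation at \<open>x j\<close> isolates the \<open>j\<close>-th coefficient of a
  combination of the \<open>f i\<close>, so these functions are linearly independent. They lie in
  the span of at most \<open>card I\<close> functions, so they already span it, and evaluation then
  identifies the coefficients of \<open>q\<close>.\<close>

lemma biorthogonal_expansion:
  fixes f :: "'i \<Rightarrow> 'b \<Rightarrow> real" and m :: "'j \<Rightarrow> 'b \<Rightarrow> real"
  assumes "finite A" "finite I" "card A \<le> card I"
    and f: "\<And>i. i \<in> I \<Longrightarrow> \<exists>c. \<forall>t. f i t = (\<Sum>j\<in>A. c j * m j t)"
    and q: "\<exists>c. \<forall>t. q t = (\<Sum>j\<in>A. c j * m j t)"
    and dual: "\<And>i j. i \<in> I \<Longrightarrow> j \<in> I \<Longrightarrow> f i (x j) = (if i = j then 1 else 0)"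
  shows "q t = (\<Sum>i\<in>I. q (x i) * f i t)"
proof -
  \<comment> \<open>Addition is the pointwise one of the function type; the pointwise scaling is
    supplied here so that the abstract results on span and independence apply.\<close>
  interpret V: vector_space "\<lambda>c (g :: 'b \<Rightarrow> real) t. c * g t"
    by unfold_locales (auto simp: fun_eq_iff algebra_simps)
  have in_span: "g \<in> V.span (m ` A)" if g: "\<exists>c. \<forall>t. g t = (\<Sum>j\<in>A. c j * m j t)" for g
  proof -
    obtain c where "\<And>t. g t = (\<Sum>j\<in>A. c j * m j t)" using g by blast
    then have "g = (\<Sum>j\<in>A. (\<lambda>t. c j * m j t))"
      by (auto simp: fun_eq_iff sum_fun_apply)
    also have "\<dots> \<in> V.span (m ` A)"
      by (intro V.span_sum V.span_scale V.span_base) auto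
    finally show ?thesis .
  qed
  have inj: "inj_on f I"
    by (rule inj_onI) (metis dual zero_neq_one)
  have comb: "(\<Sum>g\<in>f ` I. u g * g t) = (\<Sum>i\<in>I. u (f i) * f i t)" for u t
    by (simp add: sum.reindex[OF inj])
  have comb_node: "(\<Sum>g\<in>f ` I. u g * g (x j)) = u (f j)" if "j \<in> I" for u j
    using that \<open>finite I\<close> by (simp add: comb dual if_distrib sum.delta cong: if_cong)
  have indep: "V.independent (f ` I)"
  proof (rule V.independent_if_scalars_zero)
    show "finite (f ` I)" using \<open>finite I\<close> by simp
    fix u g assume 0: "(\<Sum>g\<in>f ` I. (\<lambda>t. u g * g t)) = 0" and "g \<in> f ` I"
    then obtain j where j: "j \<in> I" "g = f j" by blast
    have "(\<Sum>g\<in>f ` I. u g * g (x j)) = 0"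
      using fun_cong[OF 0, of "x j"] unfolding sum_fun_apply zero_fun_apply .
    then show "u g = 0"
      unfolding j(2) comb_node[OF j(1)] .
  qed
  have "q \<in> V.span (f ` I)"
  proof (rule ccontr)
    assume nq: "q \<notin> V.span (f ` I)"
    have "insert q (f ` I) \<subseteq> V.span (m ` A)"
      using in_span f q by blast
    then have "card (insert q (f ` I)) \<le> card (m ` A)"
      using V.independent_span_bound[of "m ` A" "insert q (f ` I)"]
        V.independent_insertI[OF nq indep] \<open>finite A\<close> by simp
    also have "\<dots> \<le> card I"
      using card_image_le[OF \<open>finite A\<close>] assms(3) by (rule order.trans)
    finally show False
      using nq V.span_base[of q "f ` I"] \<open>finite I\<close> card_image[OF inj] by fastforce
  qed
  then obtain u where u: "q = (\<Sum>g\<in>f ` I. (\<lambda>t. u g * g t))"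
    using V.span_finite[of "f ` I"] \<open>finite I\<close> by auto
  have q_eq: "q t = (\<Sum>g\<in>f ` I. u g * g t)" for t
    by (subst u) (simp add: sum_fun_apply)
  have "q (x i) = u (f i)" if "i \<in> I" for i
    using q_eq[of "x i"] comb_node[OF that] by simp
  then show ?thesis
    using q_eq[of t] by (simp add: comb)
qed

section \<open>Lagrange nodes of a simplex and unisolvence\<close>

lemma lagrange_nodes_convex_hull:
  assumes "\<not> affine_dependent V"
  shows "lagrange_nodes p (convex hull V) =
    {(\<Sum>v\<in>V. (real (\<alpha> v) / real p) *\<^sub>R v) | \<alpha>. (\<Sum>v\<in>V. \<alpha> v) = p}"
  \<comment> \<open>Affine independence makes \<open>V\<close> the set of extreme points of its
    hull, so nodes can be handled through an explicit vertex set.\<close>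
  unfolding lagrange_nodes_def extreme_point_of_convex_hull_affine_independent[OF assms] by simp

lemma lagrange_nodes_subset:
  assumes "\<not> affine_dependent V" "p \<ge> 1"
  shows "lagrange_nodes p (convex hull V) \<subseteq> convex hull V"
proof
  fix z assume "z \<in> lagrange_nodes p (convex hull V)"
  then obtain \<alpha> where \<alpha>: "z = (\<Sum>v\<in>V. (real (\<alpha> v) / real p) *\<^sub>R v)" "(\<Sum>v\<in>V. \<alpha> v) = p"
    unfolding lagrange_nodes_convex_hull[OF assms(1)] by blast
  \<comment> \<open>This uses \<open>p \<ge> 1\<close>: for \<open>p = 0\<close> division by zero
    would make every weight 0.\<close>
  have "(\<Sum>v\<in>V. real (\<alpha> v) / real p) = 1"
    using \<alpha>(2) assms(2) by (simp flip: sum_divide_distrib of_nat_sum)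
  then show "z \<in> convex hull V"
    unfolding \<alpha>(1) using aff_independent_finite[OF assms(1)]
    by (intro convex_sum) (auto intro: hull_inc)
qed

text \<open>The differences of the two families of weights sum to zero and annihilate the vertices,
  so a nonzero one among them would be an affine dependence.\<close>

lemma barycentric_unique:
  fixes V :: "'a::euclidean_space set"
  assumes "\<not> affine_dependent V" "sum u V = sum w V"
    and "(\<Sum>v\<in>V. u v *\<^sub>R v) = (\<Sum>v\<in>V. w v *\<^sub>R v)" "v \<in> V"
  shows "u v = w v"
proof (rule ccontr)
  assume "u v \<noteq> w v"
  moreover have "(\<Sum>v\<in>V. u v - w v) = 0" "(\<Sum>v\<in>V. (u v - w v) *\<^sub>R v) = 0"
    using assms by (simp_all add: sum_subtractf scaleR_diff_left)
  ultimately have "affine_dependent V"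
    using assms(4) affine_dependent_explicit_finite[OF aff_independent_finite[OF assms(1)]]
    by (auto intro!: exI[of _ "\<lambda>v. u v - w v"])
  with assms(1) show False by simp
qed

text \<open>A multi-index becomes a node by placing its entries on the vertices other than one
  chosen \<open>v0\<close> and the remainder up to \<open>p\<close> on \<open>v0\<close>. Uniqueness
  of barycentric coordinates makes this map injective, and an injection is enough for the dimension
  count.\<close>

lemma multi_indices_card_le_nodes:
  fixes V :: "'a::euclidean_space set"
  assumes V: "\<not> affine_dependent V" "card V = DIM('a) + 1" and "p \<ge> 1"
    and fin: "finite (lagrange_nodes p (convex hull V))"
  shows "finite (multi_indices p :: ('a \<Rightarrow> nat) set)"
    and "card (multi_indices p :: ('a \<Rightarrow> nat) set) \<le> card (lagrange_nodes p (convex hull V))"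
proof -
  have [simp]: "finite V" using V aff_independent_finite by blast
  obtain v0 where v0: "v0 \<in> V" using V(2) by fastforce
  have "card (V - {v0}) = card (Basis :: 'a set)" using V(2) v0 by simp
  then obtain h where h: "bij_betw h (V - {v0}) (Basis :: 'a set)"
    by (metis \<open>finite V\<close> finite_Diff finite_Basis finite_same_card_bij)
  \<comment> \<open>The truncated subtraction is exact on \<open>multi_indices p\<close>, where the
    entries sum to at most \<open>p\<close>.\<close>
  define \<beta> where "\<beta> \<alpha> v = (if v = v0 then p - (\<Sum>b\<in>Basis. \<alpha> b) else \<alpha> (h v))" for \<alpha> :: "'a \<Rightarrow> nat" and v
  define node where "node \<alpha> = (\<Sum>v\<in>V. (real (\<beta> \<alpha> v) / real p) *\<^sub>R v)" for \<alpha>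
  have sum_\<beta>: "(\<Sum>v\<in>V. \<beta> \<alpha> v) = p" if "\<alpha> \<in> multi_indices p" for \<alpha>
  proof -
    have "(\<Sum>v\<in>V - {v0}. \<beta> \<alpha> v) = (\<Sum>v\<in>V - {v0}. \<alpha> (h v))"
      by (rule sum.cong) (auto simp: \<beta>_def)
    also have "\<dots> = (\<Sum>b\<in>Basis. \<alpha> b)"
      by (rule sum.reindex_bij_betw[OF h])
    finally show ?thesis
      using that by (simp add: sum.remove[OF _ v0] multi_indices_def) (simp add: \<beta>_def)
  qed
  have maps: "node ` multi_indices p \<subseteq> lagrange_nodes p (convex hull V)"
    unfolding lagrange_nodes_convex_hull[OF V(1)] node_def using sum_\<beta> by blast
  have inj: "inj_on node (multi_indices p)"
  proof (rule inj_onI)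
    fix \<alpha> \<alpha>' assume \<alpha>: "\<alpha> \<in> multi_indices p" "\<alpha>' \<in> multi_indices p" "node \<alpha> = node \<alpha>'"
    have "(\<Sum>v\<in>V. real (\<beta> \<alpha> v) / real p) = (\<Sum>v\<in>V. real (\<beta> \<alpha>' v) / real p)"
      using sum_\<beta> \<alpha>(1,2) by (simp flip: sum_divide_distrib of_nat_sum)
    then have "real (\<beta> \<alpha> v) / real p = real (\<beta> \<alpha>' v) / real p" if "v \<in> V" for v
      using barycentric_unique[OF V(1) _ \<alpha>(3)[unfolded node_def] that] by blast
    then have eq: "\<beta> \<alpha> v = \<beta> \<alpha>' v" if "v \<in> V" for v
      using that \<open>p \<ge> 1\<close> by simp
    show "\<alpha> = \<alpha>'"
    proof
      fix b
      show "\<alpha> b = \<alpha>' b"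
      proof (cases "b \<in> Basis")
        case True
        then obtain v where "v \<in> V" "v \<noteq> v0" "b = h v"
          using h by (auto simp: bij_betw_def)
        then show ?thesis using eq[of v] by (simp add: \<beta>_def)
      next
        case False
        then show ?thesis using \<alpha> by (simp add: multi_indices_def)
      qed
    qed
  qed
  show "finite (multi_indices p :: ('a \<Rightarrow> nat) set)"
    using finite_imageD[OF finite_subset[OF maps fin] inj] .
  show "card (multi_indices p :: ('a \<Rightarrow> nat) set) \<le> card (lagrange_nodes p (convex hull V))"
    by (rule card_inj_on_le[OF inj maps fin])
qed

text \<open>The dual system consists of the nodes and their basis functions, and the spanning family
  of the monomials, of which there are no more than nodes. The identity is one of polynomials, so
  \<open>\<xi>\<close> may lie outside \<open>K\<close>.\<close>

lemma lagrange_expansion: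
  fixes K :: "'a::euclidean_space set"
  assumes "int DIM('a) simplex K" "p \<ge> 1"
    and x: "node_ordering p K L x" and \<pi>: "lagrange_basis p L x \<pi>" and q: "q \<in> polys p"
  shows "q \<xi> = (\<Sum>i=0..L. q (x i) * \<pi> i \<xi>)"
proof -
  obtain V where V: "\<not> affine_dependent V" "card V = DIM('a) + 1" "K = convex hull V"
    using assms(1) unfolding simplex_def by auto
  have bij: "bij_betw x {0..L} (lagrange_nodes p (convex hull V))"
    using x V(3) by (simp add: node_ordering_def)
  have fin: "finite (lagrange_nodes p (convex hull V))"
    using bij_betw_finite[OF bij] by simp
  note mi = multi_indices_card_le_nodes[OF V(1,2) assms(2) fin]
  show ?thesis
  proof (rule biorthogonal_expansion[OF mi(1), where x = x and I = "{0..L}"])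
    show "card (multi_indices p :: ('a \<Rightarrow> nat) set) \<le> card {0..L}"
      using mi(2) bij_betw_same_card[OF bij] by simp
    show "\<exists>c. \<forall>t. q t = (\<Sum>\<alpha>\<in>multi_indices p. c \<alpha> * (\<Prod>b\<in>Basis. (t \<bullet> b) ^ \<alpha> b))"
      using q by (simp add: polys_def)
    show "\<exists>c. \<forall>t. \<pi> i t = (\<Sum>\<alpha>\<in>multi_indices p. c \<alpha> * (\<Prod>b\<in>Basis. (t \<bullet> b) ^ \<alpha> b))"
      if "i \<in> {0..L}" for i
      using \<pi> that by (simp add: lagrange_basis_def polys_def)
  qed (use \<pi> in \<open>auto simp: lagrange_basis_def\<close>)
qed

section \<open>Bisection and the nodes of parent and children\<close>

lemma midpoint_notin_affine_independent:
  assumes "\<not> affine_dependent V" "a \<in> V" "b \<in> V" "a \<noteq> b"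
  shows "midpoint a b \<notin> V"
proof
  assume m: "midpoint a b \<in> V"
  have "midpoint a b \<in> affine hull {a, b}"
    using midpoint_in_closed_segment[of a b] convex_hull_subset_affine_hull[of "{a, b}"]
    unfolding segment_convex_hull by blast
  \<comment> \<open>Since \<open>a \<noteq> b\<close>, the midpoint differs from both ends, so
    \<open>a\<close> and \<open>b\<close> survive its removal from \<open>V\<close>.\<close>
  also have "\<dots> \<subseteq> affine hull (V - {midpoint a b})"
    using assms midpoint_eq_endpoint[of a b] by (intro hull_mono) (metis Diff_iff empty_iff insert_iff subsetI)
  finally show False
    using m assms(1) by (auto simp: affine_dependent_def)
qed

text \<open>The hull is a simplex of full dimension, so the \<open>DIM('a) + 1\<close> points that
  generate it have affine dimension \<open>DIM('a)\<close>. This forces them to be affinely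
  independent.\<close>

lemma affine_independent_child:
  fixes V :: "'a::euclidean_space set"
  assumes V: "\<not> affine_dependent V" "card V = DIM('a) + 1" "a \<in> V" "b \<in> V" "a \<noteq> b"
    and "int DIM('a) simplex (convex hull (insert (midpoint a b) (V - {b})))"
  shows "\<not> affine_dependent (insert (midpoint a b) (V - {b}))"
proof -
  have "finite V" by (rule aff_independent_finite[OF V(1)])
  moreover have "card (insert (midpoint a b) (V - {b})) = DIM('a) + 1"
    using \<open>finite V\<close> V(2,4) midpoint_notin_affine_independent[OF V(1,3-5)] by simp
  moreover have "aff_dim (insert (midpoint a b) (V - {b})) = int DIM('a)"
    using aff_dim_simplex[OF assms(6)] unfolding aff_dim_convex_hull .
  ultimately show ?thesis
    unfolding affine_independent_iff_card by simp
qed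

text \<open>The condition \<open>\<alpha> b \<le> \<alpha> a\<close> selects the half of the parent
  on the side of \<open>a\<close>, which is the child that keeps \<open>a\<close>. Passing to the
  vertices of the child keeps the weights integer multiples of \<open>1/p\<close>.\<close>

lemma node_of_child:
  assumes V: "\<not> affine_dependent V" "a \<in> V" "b \<in> V" "a \<noteq> b"
    and ind: "\<not> affine_dependent (insert (midpoint a b) (V - {b}))"
    and \<alpha>: "(\<Sum>v\<in>V. \<alpha> v) = p" "\<alpha> b \<le> \<alpha> a"
  shows "(\<Sum>v\<in>V. (real (\<alpha> v) / real p) *\<^sub>R v)
    \<in> lagrange_nodes p (convex hull (insert (midpoint a b) (V - {b})))"
proof -
  let ?m = "midpoint a b" and ?W = "V - {a, b}"
  have m: "?m \<notin> V" by (rule midpoint_notin_affine_independent[OF V])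
  have [simp]: "finite V" using V(1) aff_independent_finite by blast
  have eqs: "V = insert a (insert b ?W)" "insert ?m (V - {b}) = insert ?m (insert a ?W)"
    using V by auto
  \<comment> \<open>Replace the part \<open>\<alpha> b (a + b)\<close> of the barycentric combination by \<open>2 \<alpha> b\<close> times the midpoint.\<close>
  define \<beta> where "\<beta> v = (if v = ?m then 2 * \<alpha> b else if v = a then \<alpha> a - \<alpha> b else \<alpha> v)" for v
  have ne: "?m \<noteq> a" "?m \<noteq> b" "\<And>v. v \<in> ?W \<Longrightarrow> v \<noteq> ?m" using m V by auto
  have sumV: "sum g V = g a + (g b + sum g ?W)" for g :: "'a \<Rightarrow> 'b::comm_monoid_add"
    using V by (subst eqs(1)) simp
  have sumC: "sum g (insert ?m (V - {b})) = g ?m + (g a + sum g ?W)"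
    for g :: "'a \<Rightarrow> 'b::comm_monoid_add"
    using m ne by (subst eqs(2)) simp
  have \<beta>: "\<beta> ?m = 2 * \<alpha> b" "\<beta> a = \<alpha> a - \<alpha> b"
    by (simp_all add: \<beta>_def ne(1)[symmetric])
  have W: "sum \<beta> ?W = sum \<alpha> ?W"
    "(\<Sum>v\<in>?W. (real (\<beta> v) / real p) *\<^sub>R v) = (\<Sum>v\<in>?W. (real (\<alpha> v) / real p) *\<^sub>R v)"
    using ne by (auto intro!: sum.cong simp: \<beta>_def)
  \<comment> \<open>Here and in the next identity \<open>\<alpha> b \<le> \<alpha> a\<close> makes
    the difference of natural numbers exact.\<close>
  have "(\<Sum>v\<in>insert ?m (V - {b}). \<beta> v) = p"
    using \<alpha> W(1) by (simp add: sumV sumC \<beta>)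
  moreover have "(real (\<alpha> a) / real p) *\<^sub>R a + (real (\<alpha> b) / real p) *\<^sub>R b =
      (real (\<beta> ?m) / real p) *\<^sub>R ?m + (real (\<beta> a) / real p) *\<^sub>R a"
    using \<alpha>(2)
    unfolding \<beta>
    by (simp add: midpoint_def of_nat_diff diff_divide_distrib scaleR_diff_left scaleR_add_right)
  then have "(\<Sum>v\<in>V. (real (\<alpha> v) / real p) *\<^sub>R v) =
      (\<Sum>v\<in>insert ?m (V - {b}). (real (\<beta> v) / real p) *\<^sub>R v)"
    by (simp add: sumV sumC W(2) flip: add.assoc)
  ultimately show ?thesis
    unfolding lagrange_nodes_convex_hull[OF ind] by blast
qed

text \<open>A node belongs to the child that keeps whichever of \<open>a\<close> and
  \<open>b\<close> carries the larger weight.\<close>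

lemma bisected_nodes:
  fixes K :: "'a::euclidean_space set"
  assumes "bisected K K1 K2" "int DIM('a) simplex K1" "int DIM('a) simplex K2"
  shows "lagrange_nodes p K \<subseteq> lagrange_nodes p K1 \<union> lagrange_nodes p K2"
proof
  fix z assume z: "z \<in> lagrange_nodes p K"
  \<comment> \<open>Writing the midpoint as \<open>midpoint b a\<close> in the second child turns it
    into the first one with \<open>a\<close> and \<open>b\<close> exchanged, so one lemma serves
    both.\<close>
  obtain V a b where V: "\<not> affine_dependent V" "card V = DIM('a) + 1" "a \<in> V" "b \<in> V" "a \<noteq> b"
    and K: "K = convex hull V" "K1 = convex hull (insert (midpoint a b) (V - {b}))"
    "K2 = convex hull (insert (midpoint b a) (V - {a}))"
    using assms(1) unfolding bisected_def by (metis midpoint_sym)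
  obtain \<alpha> where \<alpha>: "z = (\<Sum>v\<in>V. (real (\<alpha> v) / real p) *\<^sub>R v)" "(\<Sum>v\<in>V. \<alpha> v) = p"
    using z unfolding K(1) lagrange_nodes_convex_hull[OF V(1)] by blast
  show "z \<in> lagrange_nodes p K1 \<union> lagrange_nodes p K2"
  proof (cases "\<alpha> b \<le> \<alpha> a")
    case True
    then show ?thesis
      using node_of_child[OF V(1,3-5) affine_independent_child[OF V] \<alpha>(2)] assms(2) K \<alpha>(1) by auto
  next
    case False
    then show ?thesis
      using node_of_child[OF V(1,4,3) V(5)[symmetric]
          affine_independent_child[OF V(1,2,4,3) V(5)[symmetric]] \<alpha>(2)] assms(3) K \<alpha>(1) by auto
  qed
qed

lemma bisected_subset:
  assumes "bisected K K1 K2"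
  shows "K1 \<subseteq> K" "K2 \<subseteq> K"
proof -
  obtain V a b where V: "a \<in> V" "b \<in> V" and K: "K = convex hull V"
    "K1 = convex hull (insert (midpoint a b) (V - {b}))"
    "K2 = convex hull (insert (midpoint a b) (V - {a}))"
    using assms unfolding bisected_def by blast
  have "midpoint a b \<in> convex hull V"
    using V by (intro midpoints_in_convex_hull) (auto intro: hull_inc)
  then have "insert (midpoint a b) (V - {b}) \<subseteq> convex hull V"
    "insert (midpoint a b) (V - {a}) \<subseteq> convex hull V"
    using hull_subset[of V convex] by blast+
  then show "K1 \<subseteq> K" "K2 \<subseteq> K"
    unfolding K by (simp_all add: hull_minimal)
qed

lemma simplex_nodes_subset:
  fixes K :: "'a::euclidean_space set"
  assumes "n simplex K" "p \<ge> 1"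
  shows "lagrange_nodes p K \<subseteq> K"
  using assms lagrange_nodes_subset unfolding simplex_def by blast

section \<open>Nodal coefficients, index maps and the error on one child\<close>

lemma lagrange_basis_coefficient:
  assumes "lagrange_basis p L x \<pi>" "j \<in> {0..L}"
  shows "(\<Sum>i=0..L. c i * \<pi> i (x j)) = c j"
proof -
  have "(\<Sum>i=0..L. c i * \<pi> i (x j)) = (\<Sum>i=0..L. if i = j then c i else 0)"
    using assms(1,2) by (intro sum.cong) (auto simp: lagrange_basis_def)
  then show ?thesis using assms(2) by simp
qed

text \<open>Injectivity of \<open>x\<close> makes the description in \<open>c_map\<close> unique,
  and injectivity of \<open>x'\<close> makes \<open>c_map\<close> injective, so
  \<open>the_inv_into\<close> is a genuine inverse.\<close>

lemma d_map_node:
  assumes "inj_on x {0..L}" "inj_on x' {0..L}" "i \<in> {0..L}" "x i \<in> x' ` {0..L}"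
  shows "i \<in> C_set L x x'" "d_map L x x' i \<in> {0..L}" "x' (d_map L x x' i) = x i"
proof -
  have c: "c_map L x x' j = i" if "i \<in> {0..L}" "x' j = x i" for i j
    unfolding c_map_def using that assms(1) by (intro the_equality) (auto dest: inj_onD)
  have inj: "inj_on (c_map L x x') (D_set L x x')"
  proof (rule inj_onI)
    fix j k assume jk: "j \<in> D_set L x x'" "k \<in> D_set L x x'" "c_map L x x' j = c_map L x x' k"
    then obtain i i' where "i \<in> {0..L}" "x' j = x i" "i' \<in> {0..L}" "x' k = x i'"
      by (auto simp: D_set_def)
    then have "x' j = x' k" using c jk(3) by metis
    then show "j = k" using jk assms(2) by (auto simp: D_set_def dest: inj_onD)
  qed
  obtain j where j: "j \<in> {0..L}" "x' j = x i" using assms(4) by auto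
  then have D: "j \<in> D_set L x x'" and cj: "c_map L x x' j = i"
    using assms(3) c by (auto simp: D_set_def)
  then have "d_map L x x' i = j"
    unfolding d_map_def using the_inv_into_f_f[OF inj D] by simp
  then show "d_map L x x' i \<in> {0..L}" "x' (d_map L x x' i) = x i"
    using j by simp_all
  show "i \<in> C_set L x x'"
    unfolding C_set_def using D cj by blast
qed

text \<open>This is the converse of the first part of \<open>d_map_node\<close>: the two together
  identify \<open>C_set\<close> with the parent nodes that are also nodes of the child.\<close>

lemma C_set_node:
  assumes "inj_on x {0..L}" "i \<in> C_set L x x'"
  shows "x i \<in> x' ` {0..L}"
proof -
  obtain j k where jk: "j \<in> {0..L}" "k \<in> {0..L}" "x' j = x k" "i = c_map L x x' j"
    using assms(2) by (auto simp: C_set_def D_set_def)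
  then have "i = k"
    unfolding jk(4) c_map_def using assms(1) by (intro the_equality) (auto dest: inj_onD)
  then show ?thesis using jk by (metis imageI)
qed

text \<open>On the child both \<open>U\<close> and \<open>q\<close> expand in the fine basis, and
  the fine coefficients of \<open>q\<close> are its values at the nodes \<open>x' j\<close>.\<close>

lemma child_coarsening_error:
  fixes K' :: "'a::euclidean_space set"
  assumes "int DIM('a) simplex K'" "p \<ge> 1"
    and x': "node_ordering p K' L x'" and \<pi>': "lagrange_basis p L x' \<pi>'"
    and U: "\<And>\<xi>. \<xi> \<in> K' \<Longrightarrow> U \<xi> = (\<Sum>j=0..L. y' j * \<pi>' j \<xi>)"
    and q: "q \<in> polys p" "\<And>\<xi>. q \<xi> = (\<Sum>i=0..L. y i * \<pi> i \<xi>)"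
    and agree: "\<And>i. i \<in> {0..L} \<Longrightarrow> q (x i) = U (x i)"
    and "\<xi> \<in> K'"
  shows "U \<xi> - q \<xi> = (\<Sum>j\<in>{0..L} - D_set L x x'.
    (y' j - (\<Sum>i=0..L. y i * coarse_on_fine \<pi> x' i j)) * \<pi>' j \<xi>)"
proof -
  have node: "U (x' j) = y' j" if "j \<in> {0..L}" for j
  proof -
    have "x' j \<in> K'"
      using simplex_nodes_subset[OF assms(1,2)] x' that
      by (auto simp: node_ordering_def bij_betw_def)
    then show ?thesis
      by (simp only: U lagrange_basis_coefficient[OF \<pi>' that])
  qed
  have "U \<xi> - q \<xi> = (\<Sum>j=0..L. (y' j - q (x' j)) * \<pi>' j \<xi>)"
    using U[OF \<open>\<xi> \<in> K'\<close>] lagrange_expansion[OF assms(1,2) x' \<pi>' q(1), of \<xi>]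
    by (simp add: left_diff_distrib sum_subtractf)
  \<comment> \<open>For \<open>j\<close> in \<open>D_set\<close> the node \<open>x' j\<close> is
    some \<open>x i\<close>, where \<open>q\<close> and \<open>U\<close> agree, so its term
    vanishes.\<close>
  also have "\<dots> = (\<Sum>j\<in>{0..L} - D_set L x x'. (y' j - q (x' j)) * \<pi>' j \<xi>)"
    using agree node by (intro sum.mono_neutral_right) (auto simp: D_set_def, metis)
  \<comment> \<open>Evaluating the coarse expansion of \<open>q\<close> at \<open>x' j\<close>
    produces the entries of column \<open>j\<close> of the coarse-on-fine matrix.\<close>
  finally show ?thesis
    by (simp add: q(2) coarse_on_fine_def)
qed

theorem theoremA10:
  fixes \<Omega> :: "'a::euclidean_space set"
    and \<T> \<T>\<^sub>0 :: "'a set set"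
    and p L :: nat
    and \<Lambda> :: "('a \<Rightarrow> real) \<Rightarrow> 'a \<Rightarrow> real"
    and U :: "'a \<Rightarrow> real"
    and K Kp Km :: "'a set"
    and x xp xm :: "nat \<Rightarrow> 'a"
    and \<pi> \<pi>p \<pi>m :: "nat \<Rightarrow> 'a \<Rightarrow> real"
    and y yp ym :: "nat \<Rightarrow> real"
  assumes "bounded \<Omega>" and "polyhedral_domain \<Omega>"
    and "mesh \<Omega> \<T>" and "mesh \<Omega> \<T>\<^sub>0" and "coarsening \<T> \<T>\<^sub>0"
    and "p \<ge> 1"
    and "lagrange_interpolator \<Omega> \<T>\<^sub>0 p \<Lambda>"
    and "U \<in> fe_space \<Omega> \<T> p"
    and "Kp \<in> \<T>" and "Km \<in> \<T>" and "K \<in> \<T>\<^sub>0" and "bisected K Kp Km"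
    and "node_ordering p K L x"
    and "node_ordering p Kp L xp"
    and "node_ordering p Km L xm"
    and "lagrange_basis p L x \<pi>"
    and "lagrange_basis p L xp \<pi>p"
    and "lagrange_basis p L xm \<pi>m"
    and "\<forall>\<xi>\<in>Kp. U \<xi> = (\<Sum>j=0..L. yp j * \<pi>p j \<xi>)"
    and "\<forall>\<xi>\<in>Km. U \<xi> = (\<Sum>j=0..L. ym j * \<pi>m j \<xi>)"
    and "\<forall>i\<in>{0..L}. y i = (if i \<in> C_set L x xp then yp (d_map L x xp i)
                                                   else ym (d_map L x xm i))"
  shows "(\<forall>\<xi>\<in>Kp. U \<xi> - \<Lambda> U \<xi> =
            (\<Sum>j\<in>{0..L} - D_set L x xp.
               (yp j - (\<Sum>i=0..L. y i * coarse_on_fine \<pi> xp i j)) * \<pi>p j \<xi>)) \<and>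
         (\<forall>\<xi>\<in>Km. U \<xi> - \<Lambda> U \<xi> =
            (\<Sum>j\<in>{0..L} - D_set L x xm.
               (ym j - (\<Sum>i=0..L. y i * coarse_on_fine \<pi> xm i j)) * \<pi>m j \<xi>))"
proof -
  let ?simplex = "\<lambda>S. int DIM('a) simplex S"
  have simp_K: "?simplex K" "?simplex Kp" "?simplex Km"
    using assms(3,4,9-11) by (auto simp: mesh_def)
  note sub = bisected_subset[OF assms(12)]
  have U: "U \<in> H10 \<Omega> \<and> continuous_on (closure \<Omega>) U"
    using assms(8) by (simp add: fe_space_def)
  then have \<Lambda>: "\<Lambda> U \<in> fe_space \<Omega> \<T>\<^sub>0 p" "\<And>z. z \<in> lagrange_nodes p K \<Longrightarrow> \<Lambda> U z = U z"
    using assms(7,11) by (auto simp: lagrange_interpolator_def)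
  obtain q where q: "q \<in> polys p" "\<And>\<xi>. \<xi> \<in> K \<Longrightarrow> \<Lambda> U \<xi> = q \<xi>"
    using \<Lambda>(1) assms(11) unfolding fe_space_def by blast
  have bij: "bij_betw x {0..L} (lagrange_nodes p K)" "bij_betw xp {0..L} (lagrange_nodes p Kp)"
    "bij_betw xm {0..L} (lagrange_nodes p Km)"
    using assms(13-15) by (simp_all add: node_ordering_def)
  have img: "x ` {0..L} = lagrange_nodes p K" "xp ` {0..L} = lagrange_nodes p Kp"
    "xm ` {0..L} = lagrange_nodes p Km"
    using bij by (simp_all add: bij_betw_def)
  have inj: "inj_on x {0..L}" "inj_on xp {0..L}" "inj_on xm {0..L}"
    using bij by (simp_all add: bij_betw_def)
  have agree: "q (x i) = U (x i)" if "i \<in> {0..L}" for i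
    using that \<Lambda>(2) q(2) simplex_nodes_subset[OF simp_K(1) assms(6)] img(1)
    by (metis image_eqI subsetD)
  have Up: "U (xp j) = yp j" if "j \<in> {0..L}" for j
  proof -
    have "xp j \<in> Kp"
      using that simplex_nodes_subset[OF simp_K(2) assms(6)] img(2) by blast
    then show ?thesis
      using assms(19) lagrange_basis_coefficient[OF assms(17) that, of yp] by metis
  qed
  have Um: "U (xm j) = ym j" if "j \<in> {0..L}" for j
  proof -
    have "xm j \<in> Km"
      using that simplex_nodes_subset[OF simp_K(3) assms(6)] img(3) by blast
    then show ?thesis
      using assms(20) lagrange_basis_coefficient[OF assms(18) that, of ym] by metis
  qed
  \<comment> \<open>For \<open>i\<close> in \<open>C_set L x xp\<close> the value is read off on
    \<open>Kp\<close>. Any other parent node is not a node of \<open>Kp\<close>, so by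
    \<open>bisected_nodes\<close> it is one of \<open>Km\<close>.\<close>
  have y: "U (x i) = y i" if i: "i \<in> {0..L}" for i
  proof (cases "i \<in> C_set L x xp")
    case True
    then show ?thesis
      using i assms(21) d_map_node[OF inj(1,2) i C_set_node[OF inj(1) True]] Up by metis
  next
    case False
    then have "x i \<notin> lagrange_nodes p Kp"
      using d_map_node(1)[OF inj(1,2) i] img(2) by blast
    then have "x i \<in> xm ` {0..L}"
      using bisected_nodes[OF assms(12) simp_K(2,3), of p] img i by blast
    then show ?thesis
      using False i assms(21) d_map_node[OF inj(1,3) i] Um by metis
  qed
  have expand: "q \<xi> = (\<Sum>i=0..L. y i * \<pi> i \<xi>)" for \<xi>
    unfolding lagrange_expansion[OF simp_K(1) assms(6,13,16) q(1), of \<xi>]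
    using agree y by (intro sum.cong) auto
  \<comment> \<open>Both children lie in the parent, so a single coarse polynomial represents the
    interpolant on each of them.\<close>
  have q_child: "\<Lambda> U \<xi> = q \<xi>" if "\<xi> \<in> Kp \<union> Km" for \<xi>
    using that q(2) sub by blast
  show ?thesis
  proof (intro conjI ballI)
    fix \<xi> assume "\<xi> \<in> Kp"
    then show "U \<xi> - \<Lambda> U \<xi> = (\<Sum>j\<in>{0..L} - D_set L x xp.
        (yp j - (\<Sum>i=0..L. y i * coarse_on_fine \<pi> xp i j)) * \<pi>p j \<xi>)"
      using child_coarsening_error[where U = U and q = q and x = x and y' = yp and y = y and \<pi> = \<pi>,
          OF simp_K(2) assms(6,14,17) bspec[OF assms(19)] q(1) expand agree] q_child by simp
  next
    fix \<xi> assume "\<xi> \<in> Km"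
    then show "U \<xi> - \<Lambda> U \<xi> = (\<Sum>j\<in>{0..L} - D_set L x xm.
        (ym j - (\<Sum>i=0..L. y i * coarse_on_fine \<pi> xm i j)) * \<pi>m j \<xi>)"
      using child_coarsening_error[where U = U and q = q and x = x and y' = ym and y = y and \<pi> = \<pi>,
          OF simp_K(3) assms(6,15,18) bspec[OF assms(20)] q(1) expand agree] q_child by simp
  qed
qed

end
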